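(* Let $C\in\mathbb{R}^{(m+p)\times n}$ and $P\in\mathbb{S}_+^n$, and assume that $CPC^T\in\mathbb{S}_{++}^{m+p}$. Then a matrix $D$ with $(D^TD)^{-1}\in\mathcal{L}$ that minimizes the ratio $$\frac{\lambda_1(DCPC^TD^T)}{\lambda_r(DCPC^TD^T)}$$ over all invertible $D\in\mathbb{R}^{(m+p)\times(m+p)}$ with $(D^TD)^{-1}\in\mathcal{L}$ can be computed by solving the semi-definite program, in the variables $t\in\mathbb{R}$ and $\mathbf{L}$, $$\text{minimize } t\quad\text{subject to}\quad tCPC^T\succeq\mathbf{L},\quad CPC^T\preceq\mathbf{L},\quad \mathbf{L}\in\mathcal{L},$$ where $\mathbf{L}=(D^TD)^{-1}$; that is, if $(t,\mathbf{L})$ is an optimal solution of this program and $D$ is invertible with $\mathbf{L}=(D^TD)^{-1}$, then $D$ minimizes the ratio. Further, $\mathbf{L}\succeq CPC^T$.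
   Context: $\mathbb{S}_+^k$ and $\mathbb{S}_{++}^k$ are the sets of symmetric positive semidefinite, respectively positive definite, real $k\times k$ matrices; $L\succeq M$ (equivalently $M\preceq L$) means $L-M$ is symmetric positive semidefinite. $\lambda_1(X)$ and $\lambda_r(X)$ denote the largest and the smallest non-zero eigenvalue of a symmetric positive semidefinite matrix $X$. The set $\mathcal{L}$ encodes a sparsity structure: given a set $\mathbb{L}\subseteq\{1,\dots,m+p\}^2$ of index pairs, $$\mathcal{L}=\{\mathbf{L}\in\mathbb{S}_{++}^{m+p}:\ \mathbf{L}=(D^TD)^{-1}\text{ for some invertible }D\in\mathbb{R}^{(m+p)\times(m+p)}\text{ with }\mathbf{L}_{ij}=[\mathbf{L}^{-1}]_{ij}=[D^{-1}]_{ij}=0\text{ if }(i,j)\notin\mathbb{L}\}.$$ It is used to represent the structures diagonal, block-diagonal, and full. In the paper's application $P$ is $H^{-1}$ for a positive definite cost matrix $H$, or the upper left $n\times n$ block of the inverse of $\begin{bmatrix} H & A^T \\ A & 0 \end{bmatrix}$ (both positive semidefinite). *)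

theory Defs
  imports "HOL-Analysis.Analysis"
begin

definition pos_semidef :: "real^'k^'k \<Rightarrow> bool" where
  "pos_semidef X \<longleftrightarrow> transpose X = X \<and> (\<forall>v. 0 \<le> v \<bullet> (X *v v))"

definition pos_def :: "real^'k^'k \<Rightarrow> bool" where
  "pos_def X \<longleftrightarrow> transpose X = X \<and> (\<forall>v. v \<noteq> 0 \<longrightarrow> 0 < v \<bullet> (X *v v))"

definition loewner_ge :: "real^'k^'k \<Rightarrow> real^'k^'k \<Rightarrow> bool"  (infix "\<succeq>" 50) where
  "L \<succeq> M \<longleftrightarrow> pos_semidef (L - M)"

definition eigenvalue :: "real^'k^'k \<Rightarrow> real \<Rightarrow> bool" where
  "eigenvalue X c \<longleftrightarrow> (\<exists>v. v \<noteq> 0 \<and> X *v v = c *\<^sub>R v)"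

text \<open>
  Both eigenvalue functions are meant for symmetric positive semidefinite matrices.
  There the set of real eigenvalues is finite and nonempty, and it has a nonzero member
  unless the matrix is zero.
\<close>

definition lambda_max :: "real^'k^'k \<Rightarrow> real" where
  "lambda_max X = Max {c. eigenvalue X c}"

definition lambda_min_nz :: "real^'k^'k \<Rightarrow> real" where
  "lambda_min_nz X = Min {c. eigenvalue X c \<and> c \<noteq> 0}"

text \<open>
  The index type \<open>'k\<close> plays the role of \<open>{1, \<dots>, m + p}\<close>; only the sum \<open>m + p\<close> matters,
  and a single type variable covers every value of it that is at least one, including those
  where \<open>m\<close> or \<open>p\<close> is zero. The set \<open>S\<close> lists the index pairs at which nonzero entries
  are permitted.
\<close>

definition sparsity_class :: "('k \<times> 'k) set \<Rightarrow> (real^'k^'k) set" where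
  "sparsity_class S = {L. pos_def L \<and>
     (\<exists>D::real^'k^'k. invertible D \<and> L = matrix_inv (transpose D ** D) \<and>
       (\<forall>i j. (i, j) \<notin> S \<longrightarrow>
          L $ i $ j = 0 \<and> matrix_inv L $ i $ j = 0 \<and> matrix_inv D $ i $ j = 0))}"

definition admissible_scaling :: "('k \<times> 'k) set \<Rightarrow> real^'k^'k \<Rightarrow> bool" where
  "admissible_scaling S D \<longleftrightarrow>
     invertible D \<and> matrix_inv (transpose D ** D) \<in> sparsity_class S"

definition eig_ratio :: "real^'n^'k \<Rightarrow> real^'n^'n \<Rightarrow> real^'k^'k \<Rightarrow> real" where
  "eig_ratio C P D =
     lambda_max (D ** C ** P ** transpose C ** transpose D) /
     lambda_min_nz (D ** C ** P ** transpose C ** transpose D)"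

definition minimizes_eig_ratio ::
  "('k \<times> 'k) set \<Rightarrow> real^'n^'k \<Rightarrow> real^'n^'n \<Rightarrow> real^'k^'k \<Rightarrow> bool" where
  "minimizes_eig_ratio S C P D \<longleftrightarrow> admissible_scaling S D \<and>
     (\<forall>E. admissible_scaling S E \<longrightarrow> eig_ratio C P D \<le> eig_ratio C P E)"

definition sdp_feasible ::
  "('k \<times> 'k) set \<Rightarrow> real^'n^'k \<Rightarrow> real^'n^'n \<Rightarrow> real \<Rightarrow> real^'k^'k \<Rightarrow> bool" where
  "sdp_feasible S C P t L \<longleftrightarrow>
     t *\<^sub>R (C ** P ** transpose C) \<succeq> L \<and> L \<succeq> C ** P ** transpose C \<and> L \<in> sparsity_class S"

definition sdp_optimal ::
  "('k \<times> 'k) set \<Rightarrow> real^'n^'k \<Rightarrow> real^'n^'n \<Rightarrow> real \<Rightarrow> real^'k^'k \<Rightarrow> bool" where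
  "sdp_optimal S C P t L \<longleftrightarrow> sdp_feasible S C P t L \<and>
     (\<forall>t' L'. sdp_feasible S C P t' L' \<longrightarrow> t \<le> t')"

end

theory Submission
  imports Defs
begin

text \<open>
  Write \<open>Q = C P C\<^sup>T\<close>. If \<open>L = (D\<^sup>T D)\<^sup>-\<^sup>1\<close>, then \<open>D L D\<^sup>T = I\<close>, so the congruence by \<open>D\<close> turns
  the pencil \<open>(Q, L)\<close> into \<open>(D Q D\<^sup>T, I)\<close>. By the variational characterization of the extreme
  eigenvalues, \<open>\<lambda>\<^sub>1(D Q D\<^sup>T)\<close> is therefore the least \<open>b\<close> with \<open>b L \<succeq> Q\<close>, and the smallest
  eigenvalue, which is positive because \<open>Q\<close> is positive definite, is the largest \<open>a\<close> with
  \<open>Q \<succeq> a L\<close> (lemmas \<open>lambda_max_congruence_le_iff\<close> and \<open>lambda_min_nz_congruence_ge_iff\<close>).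

  A feasible point \<open>(t, L)\<close> satisfies \<open>L \<succeq> Q \<succeq> t\<^sup>-\<^sup>1 L\<close>, hence \<open>\<lambda>\<^sub>1 \<le> 1\<close> and
  \<open>\<lambda>\<^sub>r \<ge> t\<^sup>-\<^sup>1\<close>, so that the ratio of \<open>D\<close> is at most \<open>t\<close> (\<open>eig_ratio_le_of_feasible\<close>).
  Conversely, given any admissible \<open>E\<close> with \<open>M = (E\<^sup>T E)\<^sup>-\<^sup>1\<close>, the ratio is unchanged when \<open>E\<close> is
  rescaled so that its largest eigenvalue becomes 1, that is, when \<open>M\<close> is replaced by \<open>\<lambda>\<^sub>1 M\<close>;
  this matrix stays in the sparsity class, since that class is a cone (\<open>sparsity_class_scaleR\<close>), and together with
  \<open>t' = \<lambda>\<^sub>1 / \<lambda>\<^sub>r\<close> it is feasible (\<open>eig_ratio_feasible\<close>). So no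
  ratio lies below the optimal value of the program, and an optimal \<open>L\<close> yields a \<open>D\<close> whose ratio
  does not exceed that value.
\<close>

section \<open>Extreme eigenvalues as bounds of the quadratic form\<close>

lemma symmetric_dot_commute:
  fixes X :: "real^'k^'k"
  assumes "transpose X = X"
  shows "u \<bullet> (X *v v) = v \<bullet> (X *v u)"
  by (metis assms dot_lmul_matrix inner_commute vector_transpose_matrix)

text \<open>
  Otherwise the form would become negative on moving from \<open>u\<close> a little in the direction of
  \<open>- Y u\<close>, along which the first-order term is \<open>- 2 |Y u|\<^sup>2\<close>.
\<close>

lemma pos_semidef_null_vector:
  fixes Y :: "real^'k^'k"
  assumes Y: "pos_semidef Y" and null: "u \<bullet> (Y *v u) = 0"
  shows "Y *v u = 0"
proof -
  define w where "w = Y *v u"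
  define b where "b = w \<bullet> (Y *v w)"
  have sym: "transpose Y = Y" and b: "0 \<le> b"
    using Y by (auto simp: pos_semidef_def b_def)
  have quad: "0 \<le> 2 * s * (w \<bullet> w) + s\<^sup>2 * b" for s
  proof -
    have "0 \<le> (u + s *\<^sub>R w) \<bullet> (Y *v (u + s *\<^sub>R w))"
      using Y by (simp add: pos_semidef_def)
    also have "\<dots> = u \<bullet> (Y *v u) + s * (u \<bullet> (Y *v w)) + s * (w \<bullet> (Y *v u)) + s\<^sup>2 * b"
      by (simp add: b_def matrix_vector_right_distrib matrix_vector_mult_scaleR
          inner_add_left inner_add_right algebra_simps power2_eq_square)
    also have "u \<bullet> (Y *v w) = w \<bullet> w"
      using symmetric_dot_commute[OF sym, of u w] by (simp add: w_def)
    finally show ?thesis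
      using null by (simp add: w_def)
  qed
  have "w \<bullet> w \<le> 0"
  proof (rule ccontr)
    define q where "q = w \<bullet> w"
    assume "\<not> w \<bullet> w \<le> 0"
    then have q: "0 < q" by (simp only: q_def not_le)
    \<comment> \<open>The parabola in \<open>s\<close> has its minimum at \<open>- q / b\<close>; adding 1 avoids dividing by \<open>b = 0\<close>
      and still gives a negative value.\<close>
    define s where "s = - q / (b + 1)"
    have "s < 0"
      using q b by (simp add: s_def divide_neg_pos)
    have "s * b = - q - s"
      using b by (simp add: s_def field_simps)
    have "2 * s * q + s\<^sup>2 * b = s * (2 * q + s * b)"
      by (simp add: algebra_simps power2_eq_square)
    also have "\<dots> = s * (q - s)"
      by (simp add: \<open>s * b = - q - s\<close>)
    also have "\<dots> < 0"
      using \<open>s < 0\<close> q by (simp add: mult_neg_pos)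
    finally show False
      using quad[of s] by (simp add: q_def)
  qed
  then show ?thesis
    by (metis inner_gt_zero_iff not_le w_def)
qed

text \<open>
  The eigenvalue is the maximum of the quadratic form on the unit sphere, and a maximizer is an
  eigenvector by the previous lemma, applied to \<open>c I - X\<close>.
\<close>

lemma symmetric_eigenvalue_upper_bound:
  fixes X :: "real^'k^'k"
  assumes sym: "transpose X = X"
  shows "\<exists>c. eigenvalue X c \<and> (\<forall>v. v \<bullet> (X *v v) \<le> c * (v \<bullet> v))"
proof -
  have "continuous_on (sphere 0 1) (\<lambda>v. v \<bullet> (X *v v))"
    by (intro continuous_intros linear_continuous_on
        bounded_linear.linear matrix_vector_mul_bounded_linear)
  moreover have "sphere (0::real^'k) 1 \<noteq> {}"
    by simp
  ultimately obtain u where u: "norm u = 1"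
    and max: "\<And>v. norm v = 1 \<Longrightarrow> v \<bullet> (X *v v) \<le> u \<bullet> (X *v u)"
    using continuous_attains_sup[OF compact_sphere] by (metis (no_types, lifting) mem_sphere_0)
  define c where "c = u \<bullet> (X *v u)"
  have bound: "v \<bullet> (X *v v) \<le> c * (v \<bullet> v)" for v
  proof (cases "v = 0")
    case False
    define e where "e = (1 / norm v) *\<^sub>R v"
    have "norm e = 1" and v: "v = norm v *\<^sub>R e"
      using False by (auto simp: e_def)
    then have "e \<bullet> (X *v e) \<le> c"
      using max by (simp add: c_def)
    then have "(norm v)\<^sup>2 * (e \<bullet> (X *v e)) \<le> (norm v)\<^sup>2 * c"
      by (intro mult_left_mono) auto
    moreover have "v \<bullet> (X *v v) = (norm v)\<^sup>2 * (e \<bullet> (X *v e))"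
      by (subst (1 2) v) (simp add: matrix_vector_mult_scaleR power2_eq_square)
    ultimately show ?thesis
      by (simp add: dot_square_norm mult.commute)
  qed simp
  have mv: "(c *\<^sub>R mat 1 - X) *v v = c *\<^sub>R v - X *v v" for v
    by (simp add: matrix_vector_mult_diff_rdistrib flip: scaleR_matrix_vector_assoc)
  have "pos_semidef (c *\<^sub>R mat 1 - X)"
    unfolding pos_semidef_def mv
    using bound sym by (simp add: inner_diff_right transpose_def vec_eq_iff mat_def)
  moreover have "u \<bullet> ((c *\<^sub>R mat 1 - X) *v u) = 0"
    unfolding mv using u by (simp add: inner_diff_right c_def dot_square_norm)
  ultimately have "X *v u = c *\<^sub>R u"
    using pos_semidef_null_vector mv by (metis eq_iff_diff_eq_0)
  with u have "eigenvalue X c"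
    unfolding eigenvalue_def by (metis norm_zero zero_neq_one)
  then show ?thesis
    using bound by blast
qed

lemma symmetric_eigenvalue_lower_bound:
  fixes X :: "real^'k^'k"
  assumes sym: "transpose X = X"
  shows "\<exists>c. eigenvalue X c \<and> (\<forall>v. c * (v \<bullet> v) \<le> v \<bullet> (X *v v))"
proof -
  have minus: "(- X) *v v = - (X *v v)" for v
    using scaleR_matrix_vector_assoc[of "-1" X v] by simp
  have "transpose (- X) = - X"
    using sym by (simp add: transpose_def vec_eq_iff)
  then obtain c where c: "eigenvalue (- X) c" "\<And>v. v \<bullet> ((- X) *v v) \<le> c * (v \<bullet> v)"
    using symmetric_eigenvalue_upper_bound by blast
  from c(1) have "eigenvalue X (- c)"
    unfolding eigenvalue_def minus by (metis minus_equation_iff scaleR_minus_left)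
  moreover have "- c * (v \<bullet> v) \<le> v \<bullet> (X *v v)" for v
    using c(2)[of v] by (simp add: minus)
  ultimately show ?thesis
    by blast
qed

text \<open>
  Eigenvectors to different eigenvalues are orthogonal, so only finitely many eigenvalues fit
  into a finite-dimensional space.
\<close>

lemma finite_eigenvalues:
  fixes X :: "real^'k^'k"
  assumes sym: "transpose X = X"
  shows "finite {c. eigenvalue X c}"
proof -
  have "\<forall>c. \<exists>v. eigenvalue X c \<longrightarrow> v \<noteq> 0 \<and> X *v v = c *\<^sub>R v"
    by (auto simp: eigenvalue_def)
  then obtain f where f: "\<And>c. eigenvalue X c \<Longrightarrow> f c \<noteq> 0 \<and> X *v f c = c *\<^sub>R f c"
    by metis
  have orth: "f c \<bullet> f d = 0" if "eigenvalue X c" "eigenvalue X d" "c \<noteq> d" for c d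
  proof -
    have "d * (f c \<bullet> f d) = c * (f c \<bullet> f d)"
      using symmetric_dot_commute[OF sym, of "f c" "f d"] f that
      by (simp add: inner_commute)
    with that show ?thesis by simp
  qed
  have "inj_on f {c. eigenvalue X c}"
    using orth f by (metis (mono_tags, lifting) inj_onI inner_eq_zero_iff mem_Collect_eq)
  moreover have "independent (f ` {c. eigenvalue X c})"
    using orth f
    by (intro pairwise_orthogonal_independent) (auto simp: pairwise_def orthogonal_def)
  ultimately show ?thesis
    using independent_imp_finite finite_imageD by blast
qed

lemma eigenvalue_le_form_bound:
  fixes X :: "real^'k^'k"
  assumes "eigenvalue X c" and "\<And>v. v \<bullet> (X *v v) \<le> b * (v \<bullet> v)"
  shows "c \<le> b"
proof -
  obtain v where v: "v \<noteq> 0" "X *v v = c *\<^sub>R v"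
    using assms(1) by (auto simp: eigenvalue_def)
  with assms(2)[of v] have "c * (v \<bullet> v) \<le> b * (v \<bullet> v)" by simp
  with v(1) show ?thesis by simp
qed

lemma eigenvalue_ge_form_bound:
  fixes X :: "real^'k^'k"
  assumes "eigenvalue X c" and "\<And>v. a * (v \<bullet> v) \<le> v \<bullet> (X *v v)"
  shows "a \<le> c"
proof -
  obtain v where v: "v \<noteq> 0" "X *v v = c *\<^sub>R v"
    using assms(1) by (auto simp: eigenvalue_def)
  with assms(2)[of v] have "a * (v \<bullet> v) \<le> c * (v \<bullet> v)" by simp
  with v(1) show ?thesis by simp
qed

lemma pos_def_eigenvalue_pos:
  fixes X :: "real^'k^'k"
  assumes "pos_def X" and "eigenvalue X c"
  shows "0 < c"
proof -
  obtain v where v: "v \<noteq> 0" "X *v v = c *\<^sub>R v"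
    using assms(2) by (auto simp: eigenvalue_def)
  then have "0 < c * (v \<bullet> v)"
    using assms(1) by (metis inner_scaleR_right pos_def_def)
  with v(1) show ?thesis
    by (metis inner_gt_zero_iff zero_less_mult_pos2)
qed

lemma eigenvalue_lambda_max:
  fixes X :: "real^'k^'k"
  assumes "transpose X = X"
  shows "eigenvalue X (lambda_max X)"
  using Max_in[OF finite_eigenvalues[OF assms]] symmetric_eigenvalue_upper_bound[OF assms]
  by (auto simp: lambda_max_def)

lemma lambda_max_le_iff:
  fixes X :: "real^'k^'k"
  assumes sym: "transpose X = X"
  shows "lambda_max X \<le> b \<longleftrightarrow> (\<forall>v. v \<bullet> (X *v v) \<le> b * (v \<bullet> v))"
proof
  assume le: "lambda_max X \<le> b"
  obtain c where c: "eigenvalue X c" "\<And>v. v \<bullet> (X *v v) \<le> c * (v \<bullet> v)"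
    using symmetric_eigenvalue_upper_bound[OF sym] by blast
  have "c \<le> lambda_max X"
    unfolding lambda_max_def using c(1) by (intro Max_ge finite_eigenvalues[OF sym]) simp
  with le have "c \<le> b" by simp
  then show "\<forall>v. v \<bullet> (X *v v) \<le> b * (v \<bullet> v)"
    using c(2) by (meson inner_ge_zero mult_right_mono order_trans)
next
  assume "\<forall>v. v \<bullet> (X *v v) \<le> b * (v \<bullet> v)"
  then show "lambda_max X \<le> b"
    using eigenvalue_le_form_bound[OF eigenvalue_lambda_max[OF sym]] by blast
qed

lemma lambda_min_nz_pos_def:
  fixes X :: "real^'k^'k"
  assumes "pos_def X"
  shows "lambda_min_nz X = Min {c. eigenvalue X c}"
  using pos_def_eigenvalue_pos[OF assms] unfolding lambda_min_nz_def
  by (metis less_irrefl)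

lemma eigenvalue_lambda_min_nz:
  fixes X :: "real^'k^'k"
  assumes "pos_def X"
  shows "eigenvalue X (lambda_min_nz X)"
proof -
  have sym: "transpose X = X"
    using assms by (simp add: pos_def_def)
  show ?thesis
    using Min_in[OF finite_eigenvalues[OF sym]] symmetric_eigenvalue_lower_bound[OF sym]
    by (auto simp: lambda_min_nz_pos_def[OF assms])
qed

lemma lambda_min_nz_ge_iff:
  fixes X :: "real^'k^'k"
  assumes X: "pos_def X"
  shows "a \<le> lambda_min_nz X \<longleftrightarrow> (\<forall>v. a * (v \<bullet> v) \<le> v \<bullet> (X *v v))"
proof
  have sym: "transpose X = X"
    using X by (simp add: pos_def_def)
  assume le: "a \<le> lambda_min_nz X"
  obtain c where c: "eigenvalue X c" "\<And>v. c * (v \<bullet> v) \<le> v \<bullet> (X *v v)"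
    using symmetric_eigenvalue_lower_bound[OF sym] by blast
  have "lambda_min_nz X \<le> c"
    unfolding lambda_min_nz_pos_def[OF X] using c(1)
    by (intro Min_le finite_eigenvalues[OF sym]) simp
  with le have "a \<le> c" by simp
  then show "\<forall>v. a * (v \<bullet> v) \<le> v \<bullet> (X *v v)"
    using c(2) by (meson inner_ge_zero mult_right_mono order_trans)
next
  assume "\<forall>v. a * (v \<bullet> v) \<le> v \<bullet> (X *v v)"
  then show "a \<le> lambda_min_nz X"
    using eigenvalue_ge_form_bound[OF eigenvalue_lambda_min_nz[OF X]] by blast
qed


section \<open>Inverses and the sparsity cone\<close>

lemma matrix_inv_mult_cancel:
  fixes A :: "real^'k^'k"
  assumes "invertible A"
  shows "A ** matrix_inv A = mat 1" and "matrix_inv A ** A = mat 1"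
  using someI_ex[OF assms[unfolded invertible_def]] by (simp_all add: matrix_inv_def)

lemma matrix_inv_eqI:
  fixes A B :: "real^'k^'k"
  assumes "A ** B = mat 1"
  shows "matrix_inv A = B"
proof -
  have "invertible A"
    using assms by (meson invertible_def matrix_left_right_inverse)
  then have "matrix_inv A ** (A ** B) = B"
    by (simp add: matrix_inv_mult_cancel matrix_mul_assoc)
  then show ?thesis
    by (simp add: assms)
qed

lemma matrix_inv_scaleR:
  fixes A :: "real^'k^'k"
  assumes "invertible A" and "a \<noteq> 0"
  shows "matrix_inv (a *\<^sub>R A) = (1 / a) *\<^sub>R matrix_inv A"
  using assms
  by (intro matrix_inv_eqI) (simp add: matrix_inv_mult_cancel matrix_scalar_ac flip: scalar_matrix_assoc)

lemma invertible_matrix_inv: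
  fixes A :: "real^'k^'k"
  assumes "invertible A"
  shows "invertible (matrix_inv A)"
  using matrix_inv_mult_cancel[OF assms] unfolding invertible_def by blast

lemma matrix_inv_gram:
  fixes D :: "real^'k^'k"
  assumes "invertible D"
  shows "matrix_inv (transpose D ** D) = matrix_inv D ** transpose (matrix_inv D)"
proof (rule matrix_inv_eqI)
  have "transpose D ** D ** (matrix_inv D ** transpose (matrix_inv D))
      = transpose D ** (D ** matrix_inv D) ** transpose (matrix_inv D)"
    by (simp add: matrix_mul_assoc)
  also have "\<dots> = transpose (matrix_inv D ** D)"
    by (simp add: matrix_inv_mult_cancel(1)[OF assms] flip: matrix_transpose_mul)
  finally show "transpose D ** D ** (matrix_inv D ** transpose (matrix_inv D)) = mat 1"
    by (simp add: matrix_inv_mult_cancel[OF assms])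
qed

lemma scaling_normalizes_form:
  fixes D :: "real^'k^'k"
  assumes D: "invertible D" and L: "L = matrix_inv (transpose D ** D)"
  shows "(transpose D *v v) \<bullet> (L *v (transpose D *v v)) = v \<bullet> v"
proof -
  have "D ** L ** transpose D
      = (D ** matrix_inv D) ** transpose (D ** matrix_inv D)"
    by (simp add: L matrix_inv_gram[OF D] matrix_mul_assoc matrix_transpose_mul)
  then have "D ** L ** transpose D = mat 1"
    by (simp add: matrix_inv_mult_cancel[OF D])
  then have "v \<bullet> (D *v (L *v (transpose D *v v))) = v \<bullet> v"
    by (metis matrix_vector_mul_assoc matrix_vector_mul_lid)
  then show ?thesis
    by (metis dot_lmul_matrix transpose_matrix_vector)
qed

text \<open>
  Rescaling \<open>L\<close> by \<open>a\<close> rescales the factor \<open>D\<close> by \<open>1 / sqrt a\<close>; neither changes which entries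
  vanish in the matrices and their inverses.
\<close>

lemma sparsity_class_scaleR:
  fixes L :: "real^'k^'k"
  assumes L: "L \<in> sparsity_class S" and a: "0 < a"
  shows "a *\<^sub>R L \<in> sparsity_class S"
proof -
  obtain D :: "real^'k^'k" where D: "invertible D" "L = matrix_inv (transpose D ** D)"
    and zero: "\<And>i j. (i, j) \<notin> S \<Longrightarrow>
      L $ i $ j = 0 \<and> matrix_inv L $ i $ j = 0 \<and> matrix_inv D $ i $ j = 0"
    using L by (auto simp: sparsity_class_def)
  define r where "r = 1 / sqrt a"
  have r: "r \<noteq> 0" "r * r = 1 / a"
    using a by (auto simp: r_def)
  have gram: "invertible (transpose D ** D)"
    using D(1) by (intro invertible_mult transpose_invertible)
  have invL: "invertible L"
    unfolding D(2) by (rule invertible_matrix_inv[OF gram])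
  have "invertible (r *\<^sub>R D)"
    using r D(1) by (simp add: scalar_invertible)
  moreover have "a *\<^sub>R L = matrix_inv (transpose (r *\<^sub>R D) ** (r *\<^sub>R D))"
  proof -
    have "transpose (r *\<^sub>R D) ** (r *\<^sub>R D) = (r * r) *\<^sub>R (transpose D ** D)"
      by (simp add: transpose_scalar matrix_scalar_ac flip: scalar_matrix_assoc)
    then show ?thesis
      using a r(2) matrix_inv_scaleR[OF gram, of "1 / a"] by (simp add: D(2))
  qed
  moreover have "pos_def (a *\<^sub>R L)"
    using L a by (simp add: sparsity_class_def pos_def_def transpose_scalar
        flip: scaleR_matrix_vector_assoc)
  moreover have "(a *\<^sub>R L) $ i $ j = 0 \<and> matrix_inv (a *\<^sub>R L) $ i $ j = 0 \<and>
      matrix_inv (r *\<^sub>R D) $ i $ j = 0" if "(i, j) \<notin> S" for i j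
    using zero[OF that] a r(1) by (simp add: matrix_inv_scaleR[OF invL] matrix_inv_scaleR[OF D(1)])
  ultimately show ?thesis
    unfolding sparsity_class_def by blast
qed


section \<open>Eigenvalues after scaling as Loewner bounds\<close>

lemma congruence_form:
  fixes D Q :: "real^'k^'k"
  shows "v \<bullet> ((D ** Q ** transpose D) *v v) = (transpose D *v v) \<bullet> (Q *v (transpose D *v v))"
  by (metis dot_lmul_matrix matrix_vector_mul_assoc transpose_matrix_vector)

lemma invertible_transpose_surj:
  fixes D :: "real^'k^'k"
  assumes "invertible D"
  obtains v where "w = transpose D *v v"
proof
  show "w = transpose D *v (matrix_inv (transpose D) *v w)"
    using matrix_inv_mult_cancel(1)[OF transpose_invertible[OF assms]]
    by (simp add: matrix_vector_mul_assoc)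
qed

lemma pos_def_congruence:
  fixes D Q :: "real^'k^'k"
  assumes Q: "pos_def Q" and D: "invertible D"
  shows "pos_def (D ** Q ** transpose D)"
  unfolding pos_def_def
proof (intro conjI allI impI)
  show "transpose (D ** Q ** transpose D) = D ** Q ** transpose D"
    using Q by (simp add: pos_def_def matrix_transpose_mul matrix_mul_assoc)
next
  fix v :: "real^'k"
  assume "v \<noteq> 0"
  then have "transpose D *v v \<noteq> 0"
    using scaling_normalizes_form[OF D refl, of v] by auto
  then show "0 < v \<bullet> ((D ** Q ** transpose D) *v v)"
    using Q by (simp add: congruence_form pos_def_def)
qed

lemma loewner_ge_iff_form:
  fixes L M :: "real^'k^'k"
  assumes "transpose L = L" and "transpose M = M"
  shows "L \<succeq> M \<longleftrightarrow> (\<forall>w. w \<bullet> (M *v w) \<le> w \<bullet> (L *v w))"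
proof -
  have "transpose (L - M) = L - M"
    using assms by (simp add: transpose_def vec_eq_iff)
  then show ?thesis
    by (simp add: loewner_ge_def pos_semidef_def matrix_vector_mult_diff_rdistrib inner_diff_right)
qed

text \<open>
  Under the substitution \<open>w = D\<^sup>T v\<close>, which reaches every \<open>w\<close>, the form of \<open>D Q D\<^sup>T\<close> at \<open>v\<close>
  becomes that of \<open>Q\<close> at \<open>w\<close>, and \<open>v \<bullet> v\<close> becomes the form of \<open>L\<close>. So a bound on the Rayleigh
  quotients of \<open>D Q D\<^sup>T\<close> is a Loewner inequality between \<open>Q\<close> and a multiple of \<open>L\<close>.
\<close>

lemma lambda_max_congruence_le_iff:
  fixes D Q L :: "real^'k^'k"
  assumes Q: "pos_def Q" and D: "invertible D" and L: "pos_def L"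
    and LD: "L = matrix_inv (transpose D ** D)"
  shows "lambda_max (D ** Q ** transpose D) \<le> b \<longleftrightarrow> b *\<^sub>R L \<succeq> Q"
proof -
  have sym: "transpose (D ** Q ** transpose D) = D ** Q ** transpose D"
    using pos_def_congruence[OF Q D] by (simp add: pos_def_def)
  have "lambda_max (D ** Q ** transpose D) \<le> b \<longleftrightarrow>
      (\<forall>v. (transpose D *v v) \<bullet> (Q *v (transpose D *v v))
        \<le> b * ((transpose D *v v) \<bullet> (L *v (transpose D *v v))))"
    by (simp only: lambda_max_le_iff[OF sym] congruence_form scaling_normalizes_form[OF D LD])
  also have "\<dots> \<longleftrightarrow> (\<forall>w. w \<bullet> (Q *v w) \<le> b * (w \<bullet> (L *v w)))"
    using invertible_transpose_surj[OF D] by metis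
  also have "\<dots> \<longleftrightarrow> b *\<^sub>R L \<succeq> Q"
    using Q L by (subst loewner_ge_iff_form)
      (simp_all add: pos_def_def transpose_scalar flip: scaleR_matrix_vector_assoc)
  finally show ?thesis .
qed

lemma lambda_min_nz_congruence_ge_iff:
  fixes D Q L :: "real^'k^'k"
  assumes Q: "pos_def Q" and D: "invertible D" and L: "pos_def L"
    and LD: "L = matrix_inv (transpose D ** D)"
  shows "a \<le> lambda_min_nz (D ** Q ** transpose D) \<longleftrightarrow> Q \<succeq> a *\<^sub>R L"
proof -
  have "a \<le> lambda_min_nz (D ** Q ** transpose D) \<longleftrightarrow>
      (\<forall>v. a * ((transpose D *v v) \<bullet> (L *v (transpose D *v v)))
        \<le> (transpose D *v v) \<bullet> (Q *v (transpose D *v v)))"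
    by (simp only: lambda_min_nz_ge_iff[OF pos_def_congruence[OF Q D]] congruence_form
        scaling_normalizes_form[OF D LD])
  also have "\<dots> \<longleftrightarrow> (\<forall>w. a * (w \<bullet> (L *v w)) \<le> w \<bullet> (Q *v w))"
    using invertible_transpose_surj[OF D] by metis
  also have "\<dots> \<longleftrightarrow> Q \<succeq> a *\<^sub>R L"
    using Q L by (subst loewner_ge_iff_form)
      (simp_all add: pos_def_def transpose_scalar flip: scaleR_matrix_vector_assoc)
  finally show ?thesis .
qed

lemma loewner_ge_scaleR_iff:
  fixes L M :: "real^'k^'k"
  assumes a: "0 < a"
  shows "a *\<^sub>R L \<succeq> a *\<^sub>R M \<longleftrightarrow> L \<succeq> M"
proof -
  have "a *\<^sub>R L - a *\<^sub>R M = a *\<^sub>R (L - M)"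
    by (simp add: scaleR_diff_right)
  then show ?thesis
    using a by (simp add: loewner_ge_def pos_semidef_def transpose_scalar zero_le_mult_iff
        flip: scaleR_matrix_vector_assoc)
qed


section \<open>The semidefinite program and the eigenvalue ratio\<close>

lemma eig_ratio_congruence:
  "eig_ratio C P D = lambda_max (D ** (C ** P ** transpose C) ** transpose D) /
     lambda_min_nz (D ** (C ** P ** transpose C) ** transpose D)"
  by (simp add: eig_ratio_def matrix_mul_assoc)

text \<open>
  The two matrix constraints read \<open>\<lambda>\<^sub>1 \<le> 1\<close> and \<open>1 / t \<le> \<lambda>\<^sub>r\<close>, the second one after division
  by \<open>t\<close>.
\<close>

lemma eig_ratio_le_of_feasible:
  fixes C :: "real^'n^'k" and P :: "real^'n^'n" and D :: "real^'k^'k"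
  assumes Q: "pos_def (C ** P ** transpose C)"
    and feas: "sdp_feasible S C P t L"
    and D: "invertible D" "L = matrix_inv (transpose D ** D)"
  shows "eig_ratio C P D \<le> t"
proof -
  define Q where "Q = C ** P ** transpose C"
  define X where "X = D ** Q ** transpose D"
  have Q': "pos_def Q"
    using Q by (simp add: Q_def)
  have L: "pos_def L" and ge: "t *\<^sub>R Q \<succeq> L" "L \<succeq> Q"
    using feas by (auto simp: sdp_feasible_def sparsity_class_def Q_def)
  have X: "pos_def X"
    unfolding X_def by (rule pos_def_congruence[OF Q' D(1)])
  have min_pos: "0 < lambda_min_nz X"
    using pos_def_eigenvalue_pos[OF X] eigenvalue_lambda_min_nz[OF X] by blast
  have max_le: "lambda_max X \<le> 1"
    unfolding X_def lambda_max_congruence_le_iff[OF Q' D(1) L D(2)] using ge by simp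
  \<comment> \<open>The forms of \<open>L\<close> and \<open>Q\<close> are both positive at any nonzero vector, and that of \<open>L\<close> is at most
    \<open>t\<close> times that of \<open>Q\<close>.\<close>
  have t: "0 < t"
  proof -
    define v :: "real^'k" where "v = axis undefined 1"
    have "v \<noteq> 0"
      by (simp add: v_def)
    then have "0 < v \<bullet> (L *v v)" "0 < v \<bullet> (Q *v v)"
      using L Q' by (auto simp: pos_def_def)
    moreover have "v \<bullet> (L *v v) \<le> t * (v \<bullet> (Q *v v))"
      using ge(1) by (simp add: loewner_ge_def pos_semidef_def matrix_vector_mult_diff_rdistrib
          inner_diff_right flip: scaleR_matrix_vector_assoc)
    ultimately show ?thesis
      by (smt (verit) mult_nonneg_nonneg zero_less_mult_pos2)
  qed
  have "Q \<succeq> (1 / t) *\<^sub>R L"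
    using loewner_ge_scaleR_iff[OF t, of Q "(1 / t) *\<^sub>R L"] ge(1) t by simp
  then have "1 / t \<le> lambda_min_nz X"
    unfolding X_def lambda_min_nz_congruence_ge_iff[OF Q' D(1) L D(2)] .
  then have "1 \<le> t * lambda_min_nz X"
    using t by (simp add: field_simps)
  then have "lambda_max X / lambda_min_nz X \<le> t"
    using max_le min_pos by (simp add: divide_le_eq)
  then show ?thesis
    by (simp add: eig_ratio_congruence X_def Q_def)
qed

text \<open>
  The witness is \<open>\<lambda>\<^sub>1 (E\<^sup>T E)\<^sup>-\<^sup>1\<close>, the smallest multiple of \<open>(E\<^sup>T E)\<^sup>-\<^sup>1\<close> that dominates
  \<open>C P C\<^sup>T\<close>; the ratio is then the smallest \<open>t\<close> that goes with it.
\<close>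

lemma eig_ratio_feasible:
  fixes C :: "real^'n^'k" and P :: "real^'n^'n" and E :: "real^'k^'k"
  assumes Q: "pos_def (C ** P ** transpose C)"
    and E: "admissible_scaling S E"
  shows "\<exists>M. sdp_feasible S C P (eig_ratio C P E) M"
proof -
  define Q where "Q = C ** P ** transpose C"
  define M where "M = matrix_inv (transpose E ** E)"
  define X where "X = E ** Q ** transpose E"
  have Q': "pos_def Q"
    using Q by (simp add: Q_def)
  have inv: "invertible E" and MS: "M \<in> sparsity_class S"
    using E by (auto simp: admissible_scaling_def M_def)
  then have M: "pos_def M"
    by (simp add: sparsity_class_def)
  have X: "pos_def X"
    unfolding X_def by (rule pos_def_congruence[OF Q' inv])
  then have max_pos: "0 < lambda_max X" and min_pos: "0 < lambda_min_nz X"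
    using pos_def_eigenvalue_pos[OF X] eigenvalue_lambda_min_nz[OF X] eigenvalue_lambda_max[of X]
    by (auto simp: pos_def_def)
  define t where "t = lambda_max X / lambda_min_nz X"
  have upper: "lambda_max X *\<^sub>R M \<succeq> Q"
    using lambda_max_congruence_le_iff[OF Q' inv M M_def, of "lambda_max X"] by (simp add: X_def)
  have "Q \<succeq> lambda_min_nz X *\<^sub>R M"
    using lambda_min_nz_congruence_ge_iff[OF Q' inv M M_def, of "lambda_min_nz X"]
    by (simp add: X_def)
  moreover have "0 < t"
    using max_pos min_pos by (simp add: t_def)
  ultimately have "t *\<^sub>R Q \<succeq> t *\<^sub>R (lambda_min_nz X *\<^sub>R M)"
    by (simp only: loewner_ge_scaleR_iff)
  then have "t *\<^sub>R Q \<succeq> lambda_max X *\<^sub>R M"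
    using min_pos by (simp add: t_def)
  moreover have "lambda_max X *\<^sub>R M \<in> sparsity_class S"
    using sparsity_class_scaleR[OF MS max_pos] .
  moreover have "eig_ratio C P E = t"
    by (simp add: eig_ratio_congruence t_def X_def Q_def)
  ultimately show ?thesis
    using upper by (auto simp: sdp_feasible_def Q_def)
qed

theorem proposition24:
  fixes C :: "real^'n^'k" and P :: "real^'n^'n" and S :: "('k \<times> 'k) set"
    and t :: real and L :: "real^'k^'k"
  assumes "pos_semidef P"
    and "pos_def (C ** P ** transpose C)"
    and "sdp_optimal S C P t L"
  shows "(\<exists>D::real^'k^'k. invertible D \<and> L = matrix_inv (transpose D ** D)) \<and>
    (\<forall>D::real^'k^'k. invertible D \<and> L = matrix_inv (transpose D ** D) \<longrightarrow> minimizes_eig_ratio S C P D) \<and>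
    L \<succeq> C ** P ** transpose C"
proof (intro conjI allI impI)
  have feas: "sdp_feasible S C P t L"
    and opt: "\<And>t' L'. sdp_feasible S C P t' L' \<Longrightarrow> t \<le> t'"
    using assms(3) by (auto simp: sdp_optimal_def)
  then have LS: "L \<in> sparsity_class S"
    by (simp add: sdp_feasible_def)
  then show "\<exists>D::real^'k^'k. invertible D \<and> L = matrix_inv (transpose D ** D)"
    by (auto simp: sparsity_class_def)
  show "L \<succeq> C ** P ** transpose C"
    using feas by (simp add: sdp_feasible_def)
  fix D :: "real^'k^'k"
  assume D: "invertible D \<and> L = matrix_inv (transpose D ** D)"
  have "eig_ratio C P D \<le> eig_ratio C P E" if "admissible_scaling S E" for E
  proof -
    have "eig_ratio C P D \<le> t"
      using eig_ratio_le_of_feasible[OF assms(2) feas] D by blast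
    also have "t \<le> eig_ratio C P E"
      using eig_ratio_feasible[OF assms(2) that] opt by blast
    finally show ?thesis .
  qed
  then show "minimizes_eig_ratio S C P D"
    using D LS by (auto simp: minimizes_eig_ratio_def admissible_scaling_def)
qed

end
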